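(* Let $G$ be a group, $A$ a finite set with at least two elements, and $T\colon A^G\to A^G$ an injective cellular automaton. Let $N\subseteq G$ be a finite injectivity set for $T$ containing $1_G$, and let $M\subseteq G$ be a finite injectivity set for $T^{-1}\colon T[A^G]\to A^G$ containing $1_G$. Then: (1) $T[A^G]\subseteq A^G$ is a subshift of finite type, and moreover it can be defined by a finite set of forbidden patterns all having domain $MN$. (2) More generally, for $n\in\mathbb{N}$ let $X^n=T^n[A^G]$. Then $X^n$ is a subshift of finite type which can be defined by a finite set of forbidden patterns all having domain $MN^n$. (3) If $T$ is not surjective, then there exists a Garden of Eden pattern for $T$ with domain $MN$.
   Context: $A^G$ carries the product topology ($A$ discrete), and $G$ acts by $(g\cdot f)(x)=f(g^{-1}x)$. A subshift is a closed $G$-invariant subset of $A^G$. A cellular automaton between subshifts is a continuous $G$-equivariant map. For a cellular automaton $T\colon X\to A^G$ defined on a subshift $X\subseteq A^G$, a finite set $N\subseteq G$ is an injectivity set for $T$ if for all $x,y\in X$ and $g\in G$ with $x(g)\neq y(g)$ there is $h\in gN$ with $T(x)(h)\neq T(y)(h)$. (Every injective cellular automaton has a finite injectivity set; for injective $T$ on $A^G$, the inverse $T^{-1}\colon T[A^G]\to A^G$ is an injective cellular automaton on the subshift $T[A^G]$.) A pattern is a map $p\colon D\to A$ with $D\subseteq G$; it is finite if $D$ is finite. A subshift $X$ is of finite type if there are finitely many finite patterns $p_1,\dots,p_k$ (the forbidden patterns, which are said to define $X$) such that for $x\in A^G$: $x\in X$ if and only if there are no $g\in G$ and $i\le k$ with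 $(g\cdot x)\upharpoonright \mathrm{dom}(p_i)=p_i$. A Garden of Eden pattern for $T\colon A^G\to A^G$ is a pattern $p\colon D\to A$ such that no $f\in T[A^G]$ satisfies $f\upharpoonright D=p$. For subsets of $G$, $MN=\{mn: m\in M,n\in N\}$ and $N^n$ is the $n$-fold product set. *)

theory Defs
  imports "HOL-Analysis.Analysis" "HOL-Algebra.Coset"
begin

text \<open>Configurations over a group \<open>G\<close> with alphabet \<open>A\<close> are extensional functions on
  \<open>carrier G\<close> (value \<open>undefined\<close> outside), so that equality of configurations is equality on
  \<open>carrier G\<close>; patterns with domain \<open>D\<close> are likewise extensional on \<open>D\<close>.\<close>

definition configs :: "('g, 'm) monoid_scheme \<Rightarrow> 'a set \<Rightarrow> ('g \<Rightarrow> 'a) set"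
  where "configs G A = carrier G \<rightarrow>\<^sub>E A"

definition config_topology :: "('g, 'm) monoid_scheme \<Rightarrow> 'a set \<Rightarrow> ('g \<Rightarrow> 'a) topology"
  where "config_topology G A = product_topology (\<lambda>_. discrete_topology A) (carrier G)"

lemma topspace_config_topology: "topspace (config_topology G A) = configs G A"
  by (simp add: config_topology_def configs_def)

definition shift :: "('g, 'm) monoid_scheme \<Rightarrow> 'g \<Rightarrow> ('g \<Rightarrow> 'a) \<Rightarrow> 'g \<Rightarrow> 'a"
  where "shift G g f = (\<lambda>x\<in>carrier G. f (inv\<^bsub>G\<^esub> g \<otimes>\<^bsub>G\<^esub> x))"

definition subshift :: "('g, 'm) monoid_scheme \<Rightarrow> 'a set \<Rightarrow> ('g \<Rightarrow> 'a) set \<Rightarrow> bool"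
  where "subshift G A X \<longleftrightarrow>
    closedin (config_topology G A) X \<and> (\<forall>g\<in>carrier G. \<forall>x\<in>X. shift G g x \<in> X)"

definition cellular_automaton ::
    "('g, 'm) monoid_scheme \<Rightarrow> 'a set \<Rightarrow> ('g \<Rightarrow> 'a) set \<Rightarrow> ('g \<Rightarrow> 'a) set
      \<Rightarrow> (('g \<Rightarrow> 'a) \<Rightarrow> 'g \<Rightarrow> 'a) \<Rightarrow> bool"
  where "cellular_automaton G A X Y T \<longleftrightarrow>
    subshift G A X \<and> subshift G A Y \<and>
    continuous_map (subtopology (config_topology G A) X) (subtopology (config_topology G A) Y) T \<and>
    (\<forall>g\<in>carrier G. \<forall>x\<in>X. T (shift G g x) = shift G g (T x))"

definition injectivity_set ::
    "('g, 'm) monoid_scheme \<Rightarrow> ('g \<Rightarrow> 'a) set \<Rightarrow> (('g \<Rightarrow> 'a) \<Rightarrow> 'g \<Rightarrow> 'a) \<Rightarrow> 'g set \<Rightarrow> bool"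
  where "injectivity_set G X T N \<longleftrightarrow>
    finite N \<and> N \<subseteq> carrier G \<and>
    (\<forall>x\<in>X. \<forall>y\<in>X. \<forall>g\<in>carrier G. x g \<noteq> y g \<longrightarrow> (\<exists>h\<in>g <#\<^bsub>G\<^esub> N. T x h \<noteq> T y h))"

text \<open>A pattern is a pair of its domain and a map on that domain. The domain is recorded
  explicitly, since it cannot in general be read off from an extensional HOL function.\<close>

type_synonym ('g, 'a) pattern = "'g set \<times> ('g \<Rightarrow> 'a)"

definition patterns :: "('g, 'm) monoid_scheme \<Rightarrow> 'a set \<Rightarrow> ('g, 'a) pattern set"
  where "patterns G A = {(D, p). D \<subseteq> carrier G \<and> p \<in> D \<rightarrow>\<^sub>E A}"

definition finite_patterns :: "('g, 'm) monoid_scheme \<Rightarrow> 'a set \<Rightarrow> ('g, 'a) pattern set"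
  where "finite_patterns G A = {P \<in> patterns G A. finite (fst P)}"

definition defined_by_forbidden ::
    "('g, 'm) monoid_scheme \<Rightarrow> 'a set \<Rightarrow> ('g, 'a) pattern set \<Rightarrow> ('g \<Rightarrow> 'a) set \<Rightarrow> bool"
  where "defined_by_forbidden G A F X \<longleftrightarrow>
    finite F \<and> F \<subseteq> finite_patterns G A \<and>
    (\<forall>x\<in>configs G A. x \<in> X \<longleftrightarrow>
       \<not> (\<exists>g\<in>carrier G. \<exists>(D, p)\<in>F. restrict (shift G g x) D = p))"

definition subshift_of_finite_type :: "('g, 'm) monoid_scheme \<Rightarrow> 'a set \<Rightarrow> ('g \<Rightarrow> 'a) set \<Rightarrow> bool"
  where "subshift_of_finite_type G A X \<longleftrightarrow>
    subshift G A X \<and> (\<exists>F. defined_by_forbidden G A F X)"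

definition garden_of_eden_pattern ::
    "('g, 'm) monoid_scheme \<Rightarrow> 'a set \<Rightarrow> (('g \<Rightarrow> 'a) \<Rightarrow> 'g \<Rightarrow> 'a) \<Rightarrow> ('g, 'a) pattern \<Rightarrow> bool"
  where "garden_of_eden_pattern G A T P \<longleftrightarrow>
    P \<in> patterns G A \<and> \<not> (\<exists>f\<in>T ` configs G A. restrict f (fst P) = snd P)"

primrec set_power :: "('g, 'm) monoid_scheme \<Rightarrow> 'g set \<Rightarrow> nat \<Rightarrow> 'g set"
  where
    "set_power G N 0 = {\<one>\<^bsub>G\<^esub>}"
  | "set_power G N (Suc n) = set_power G N n <#>\<^bsub>G\<^esub> N"

end

theory Submission
  imports Defs
begin

text \<open>
  The two injectivity sets are memory sets in disguise. That \<open>N\<close> is an injectivity set for \<open>T\<close>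
  says that \<open>x g\<close> can be read off from \<open>T x\<close> on the window \<open>g N\<close>; that \<open>M\<close> is one for the inverse
  says that \<open>T x g\<close> can be read off from \<open>x\<close> on \<open>g M\<close>.

  Suppose that on every translate \<open>g M N\<close> a configuration \<open>z\<close> looks like some point \<open>T (w g)\<close> of
  the image. Decoding \<open>z\<close> through the windows \<open>g N\<close> gives a configuration \<open>y\<close> with \<open>y g = w g g\<close>.
  All windows \<open>g m N\<close> with \<open>m \<in> M\<close> lie in \<open>g M N\<close>, so \<open>y\<close> agrees with \<open>w g\<close> on all of \<open>g M\<close>, and
  therefore \<open>T y g = T (w g) g = z g\<close>. Hence \<open>z = T y\<close>: the image consists of exactly those
  configurations that look right on all translates of \<open>M N\<close>, and the patterns on \<open>M N\<close> that do not
  occur in the image define it.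

  The same decoding passes local determination along \<open>T\<close>. If \<open>Y\<close> is determined by its windows of
  shape \<open>D\<close>, where \<open>M \<subseteq> D\<close>, and the points \<open>w g\<close> are taken in \<open>Y\<close>, then \<open>y\<close> agrees with \<open>w g\<close> even
  on \<open>g D\<close>, so \<open>y \<in> Y\<close>; thus \<open>T ` Y\<close> is determined by windows of shape \<open>D N\<close>
  (\<open>window_determined_image\<close>). Starting from the full shift and \<open>D = M\<close>, induction gives the shape
  \<open>M N\<^sup>n\<close> for the image of the \<open>n\<close>-th iterate, and \<open>n = 1\<close> is the image of \<open>T\<close> itself. If \<open>T\<close> is
  not surjective, the set of forbidden patterns cannot be empty, and any of its members is a
  Garden of Eden pattern.
\<close>

section \<open>Windows and forbidden patterns\<close>

text \<open>Membership in \<open>Y\<close> can be tested on the translates of \<open>D\<close>, one at a time: the witness \<open>x\<close> may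
  depend on \<open>g\<close>.\<close>

definition window_determined ::
    "('g, 'm) monoid_scheme \<Rightarrow> 'a set \<Rightarrow> 'g set \<Rightarrow> ('g \<Rightarrow> 'a) set \<Rightarrow> bool"
  where "window_determined G A D Y \<longleftrightarrow>
    (\<forall>z\<in>configs G A.
       (\<forall>g\<in>carrier G. \<exists>x\<in>Y. \<forall>h\<in>g <#\<^bsub>G\<^esub> D. x h = z h) \<longrightarrow> z \<in> Y)"

definition absent_patterns :: "'a set \<Rightarrow> 'g set \<Rightarrow> ('g \<Rightarrow> 'a) set \<Rightarrow> ('g, 'a) pattern set"
  where "absent_patterns A D Y = {D} \<times> ((D \<rightarrow>\<^sub>E A) - (\<lambda>x. restrict x D) ` Y)"

lemma shift_in_configs:
  assumes "group G" "g \<in> carrier G" "x \<in> configs G A"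
  shows "shift G g x \<in> configs G A"
proof -
  interpret group G by fact
  show ?thesis using assms(2,3) by (auto simp: shift_def configs_def)
qed

lemma subshift_configs:
  assumes "group G"
  shows "subshift G A (configs G A)"
  using shift_in_configs[OF assms]
  by (auto simp: subshift_def simp flip: topspace_config_topology)

lemma subshift_subset_configs: "subshift G A X \<Longrightarrow> X \<subseteq> configs G A"
  by (auto simp: subshift_def dest: closedin_subset simp flip: topspace_config_topology)

text \<open>Invariance of \<open>Y\<close> under shifts moves a window at \<open>g\<close> to one at the identity, so a single
  shape \<open>D\<close> of patterns tests all windows; finiteness of \<open>D\<close> and \<open>A\<close> leaves only finitely many
  patterns of that shape.\<close>

lemma absent_patterns_define:
  fixes G :: "('g, 'm) monoid_scheme"
  assumes "group G" and "finite A" and "finite D" and D: "D \<subseteq> carrier G"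
    and Y: "subshift G A Y" and det: "window_determined G A D Y"
  shows "defined_by_forbidden G A (absent_patterns A D Y) Y"
  unfolding defined_by_forbidden_def
proof (intro conjI ballI)
  interpret group G by fact
  show "finite (absent_patterns A D Y)"
    using assms(2,3) by (simp add: absent_patterns_def finite_PiE)
  show "absent_patterns A D Y \<subseteq> finite_patterns G A"
    using assms(3) D by (auto simp: absent_patterns_def finite_patterns_def patterns_def)
  have inv: "shift G g x \<in> Y" if "g \<in> carrier G" "x \<in> Y" for g x
    using Y that by (simp add: subshift_def)
  fix z assume z: "z \<in> configs G A"
  show "z \<in> Y \<longleftrightarrow> \<not> (\<exists>g\<in>carrier G. \<exists>(E, p)\<in>absent_patterns A D Y. restrict (shift G g z) E = p)"
  proof
    assume "z \<in> Y"
    then show "\<not> (\<exists>g\<in>carrier G. \<exists>(E, p)\<in>absent_patterns A D Y. restrict (shift G g z) E = p)"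
      using inv by (force simp: absent_patterns_def)
  next
    assume none: "\<not> (\<exists>g\<in>carrier G. \<exists>(E, p)\<in>absent_patterns A D Y. restrict (shift G g z) E = p)"
    have "\<exists>x\<in>Y. \<forall>h\<in>g <#\<^bsub>G\<^esub> D. x h = z h" if g: "g \<in> carrier G" for g
    proof -
      \<comment> \<open>Shifting by the inverse of \<open>g\<close> brings the window \<open>g D\<close> of \<open>z\<close> to \<open>D\<close>.\<close>
      let ?s = "shift G (inv\<^bsub>G\<^esub> g) z"
      have "?s \<in> configs G A"
        using shift_in_configs[OF assms(1) _ z] g by simp
      then have "restrict ?s D \<in> D \<rightarrow>\<^sub>E A"
        using D by (auto simp: configs_def)
      then have "restrict ?s D \<in> (\<lambda>x. restrict x D) ` Y"
        using none g by (auto simp: absent_patterns_def)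
      then obtain x where x: "x \<in> Y" "restrict ?s D = restrict x D"
        by auto
      have "shift G g x (g \<otimes>\<^bsub>G\<^esub> d) = z (g \<otimes>\<^bsub>G\<^esub> d)" if "d \<in> D" for d
      proof -
        have "d \<in> carrier G" using D that by auto
        moreover have "?s d = x d" using x(2) that by (metis restrict_apply')
        ultimately show ?thesis
          using g by (simp add: shift_def inv_solve_left' flip: m_assoc)
      qed
      then show ?thesis
        using inv[OF g x(1)] by (auto simp: l_coset_def)
    qed
    then show "z \<in> Y"
      using det z by (auto simp: window_determined_def)
  qed
qed

section \<open>Images of cellular automata\<close>

text \<open>Closedness survives because a full shift over a finite alphabet is compact and Hausdorff.\<close>

lemma subshift_image:
  assumes "finite A" and T: "cellular_automaton G A X Z T" and Y: "subshift G A Y" "Y \<subseteq> X"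
  shows "subshift G A (T ` Y)"
  unfolding subshift_def
proof (intro conjI ballI)
  let ?C = "config_topology G A"
  have "compact_space ?C"
    using assms(1)
    by (simp add: config_topology_def compact_space_product_topology compact_space_discrete_topology)
  then have "compactin ?C Y"
    using Y(1) by (simp add: subshift_def closedin_compact_space)
  then have "compactin (subtopology ?C X) Y"
    using Y(2) by (simp add: compactin_subtopology)
  moreover have "continuous_map (subtopology ?C X) ?C T"
    using T by (auto simp: cellular_automaton_def continuous_map_in_subtopology)
  ultimately have "compactin ?C (T ` Y)"
    by (rule image_compactin)
  moreover have "Hausdorff_space ?C"
    by (simp add: config_topology_def Hausdorff_space_product_topology)
  ultimately show "closedin ?C (T ` Y)"
    by (simp add: compactin_imp_closedin)
next
  fix g u assume g: "g \<in> carrier G" and "u \<in> T ` Y"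
  then obtain y where y: "y \<in> Y" "u = T y" by auto
  then have "shift G g u = T (shift G g y)"
    using T Y(2) g by (auto simp: cellular_automaton_def)
  then show "shift G g u \<in> T ` Y"
    using Y(1) g y(1) by (auto simp: subshift_def)
qed

lemma l_coset_of_l_coset:
  assumes "group G" "P \<subseteq> carrier G" "Q \<subseteq> carrier G" "g \<in> carrier G"
    and "h \<in> g <#\<^bsub>G\<^esub> P" "k \<in> h <#\<^bsub>G\<^esub> Q"
  shows "k \<in> g <#\<^bsub>G\<^esub> (P <#>\<^bsub>G\<^esub> Q)"
proof -
  interpret group G by fact
  obtain p q where "p \<in> P" "q \<in> Q" "k = g \<otimes>\<^bsub>G\<^esub> p \<otimes>\<^bsub>G\<^esub> q"
    using assms(5,6) by (auto simp: l_coset_def)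
  moreover from this have "k = g \<otimes>\<^bsub>G\<^esub> (p \<otimes>\<^bsub>G\<^esub> q)"
    using assms(2-4) by (metis m_assoc subsetD)
  ultimately show ?thesis unfolding l_coset_def set_mult_def by blast
qed

text \<open>An injectivity set for the inverse is a memory set for the map itself.\<close>

lemma memory_set_if_inverse_injectivity_set:
  assumes "injectivity_set G (T ` X) (inv_into X T) M" and "inj_on T X"
    and "x \<in> X" "y \<in> X" "g \<in> carrier G" and "\<forall>h\<in>g <#\<^bsub>G\<^esub> M. x h = y h"
  shows "T x g = T y g"
  using assms unfolding injectivity_set_def by (metis imageI inv_into_f_f)

text \<open>The decoding step: the windows \<open>k N\<close> with \<open>k \<in> g D\<close> all lie in \<open>g D N\<close>, so one witness for
  the latter recovers the preimage simultaneously on the whole of \<open>g D\<close>. This uses that \<open>D\<close>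
  contains \<open>M\<close> to verify that the decoded configuration is mapped to \<open>z\<close>, and that \<open>Y\<close> is
  determined on \<open>D\<close> to verify that it belongs to \<open>Y\<close>.\<close>

lemma window_determined_image:
  fixes G :: "('g, 'm) monoid_scheme"
  assumes "group G"
    and T: "T \<in> configs G A \<rightarrow> configs G A" "inj_on T (configs G A)"
    and N: "injectivity_set G (configs G A) T N" "\<one>\<^bsub>G\<^esub> \<in> N"
    and M: "injectivity_set G (T ` configs G A) (inv_into (configs G A) T) M" "\<one>\<^bsub>G\<^esub> \<in> M"
    and D: "M \<subseteq> D" "D \<subseteq> carrier G"
    and Y: "Y \<subseteq> configs G A" and det: "window_determined G A D Y"
  shows "window_determined G A (D <#>\<^bsub>G\<^esub> N) (T ` Y)"
  unfolding window_determined_def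
proof (intro ballI impI)
  interpret group G by fact
  have NG: "N \<subseteq> carrier G" using N(1) by (simp add: injectivity_set_def)
  have self: "k \<in> k <#\<^bsub>G\<^esub> P" if "k \<in> carrier G" "\<one>\<^bsub>G\<^esub> \<in> P" for k P
    using that by (force simp: l_coset_def)
  fix z assume z: "z \<in> configs G A"
    and "\<forall>g\<in>carrier G. \<exists>u\<in>T ` Y. \<forall>h\<in>g <#\<^bsub>G\<^esub> (D <#>\<^bsub>G\<^esub> N). u h = z h"
  then have "\<forall>g\<in>carrier G. \<exists>x\<in>Y. \<forall>h\<in>g <#\<^bsub>G\<^esub> (D <#>\<^bsub>G\<^esub> N). T x h = z h"
    by simp
  then obtain w where wY: "\<And>g. g \<in> carrier G \<Longrightarrow> w g \<in> Y"
    and w: "\<And>g h. \<lbrakk>g \<in> carrier G; h \<in> g <#\<^bsub>G\<^esub> (D <#>\<^bsub>G\<^esub> N)\<rbrakk> \<Longrightarrow> T (w g) h = z h"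
    by metis
  define y where "y = (\<lambda>g\<in>carrier G. w g g)"
  have y: "y \<in> configs G A"
    using wY Y by (fastforce simp: y_def configs_def)
  have near: "T (w g) h = z h"
    if "g \<in> carrier G" "k \<in> g <#\<^bsub>G\<^esub> D" "h \<in> k <#\<^bsub>G\<^esub> N" for g k h
    using w l_coset_of_l_coset[OF assms(1) D(2) NG] that by blast
  have one_D: "\<one>\<^bsub>G\<^esub> \<in> D" using M(2) D(1) by auto
  have agree: "y k = w g k" if g: "g \<in> carrier G" and k: "k \<in> g <#\<^bsub>G\<^esub> D" for g k
  proof -
    have kG: "k \<in> carrier G" using g k D(2) by (auto simp: l_coset_def)
    \<comment> \<open>Both \<open>w k\<close> and \<open>w g\<close> map to something that agrees with \<open>z\<close> on \<open>k N\<close>.\<close>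
    have "\<forall>h\<in>k <#\<^bsub>G\<^esub> N. T (w k) h = T (w g) h"
      using near[OF kG self[OF kG one_D]] near[OF g k] by simp
    then have "w k k = w g k"
      using N(1) wY[OF g] wY[OF kG] Y kG unfolding injectivity_set_def by blast
    then show ?thesis using kG by (simp add: y_def)
  qed
  have "\<forall>g\<in>carrier G. \<exists>x\<in>Y. \<forall>h\<in>g <#\<^bsub>G\<^esub> D. x h = y h"
    using agree wY by fastforce
  then have "y \<in> Y"
    using det y by (simp add: window_determined_def)
  moreover have "T y = z"
  proof (rule PiE_ext)
    show "T y \<in> carrier G \<rightarrow>\<^sub>E A" "z \<in> carrier G \<rightarrow>\<^sub>E A"
      using T(1) y z by (auto simp: configs_def)
    fix g assume g: "g \<in> carrier G"
    have "\<forall>h\<in>g <#\<^bsub>G\<^esub> M. y h = w g h"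
      using agree[OF g] D(1) by (auto simp: l_coset_def)
    then have "T y g = T (w g) g"
      using memory_set_if_inverse_injectivity_set[OF M(1) T(2) y _ g] wY[OF g] Y by blast
    also have "\<dots> = z g"
      using near[OF g self[OF g one_D] self[OF g N(2)]] .
    finally show "T y g = z g" .
  qed
  ultimately show "z \<in> T ` Y" by auto
qed

section \<open>Iterated images\<close>

lemma set_power_properties:
  assumes "group G" "finite N" "N \<subseteq> carrier G" "\<one>\<^bsub>G\<^esub> \<in> N"
  shows "finite (set_power G N n) \<and> set_power G N n \<subseteq> carrier G \<and> \<one>\<^bsub>G\<^esub> \<in> set_power G N n"
proof -
  interpret group G by fact
  show ?thesis
  proof (induction n)
    case (Suc n)
    then have "finite (set_power G N (Suc n))"
      using assms(2) by (auto simp: set_mult_def)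
    moreover have "\<one>\<^bsub>G\<^esub> \<in> set_power G N (Suc n)"
      using Suc assms(4) by (force simp: set_mult_def)
    ultimately show ?case
      using Suc assms(3) by (simp add: set_mult_closed)
  qed simp
qed

lemma subset_set_mult_right:
  assumes "group G" "M \<subseteq> carrier G" "\<one>\<^bsub>G\<^esub> \<in> P"
  shows "M \<subseteq> M <#>\<^bsub>G\<^esub> P"
proof -
  interpret group G by fact
  show ?thesis using assms(2,3) by (force simp: set_mult_def)
qed

text \<open>A configuration outside the image can only be excluded by some forbidden pattern. That pattern
  occurs nowhere in any point of the image, in particular not at the identity.\<close>

lemma garden_of_eden_pattern_if_defined:
  assumes "group G" and F: "defined_by_forbidden G A F (T ` configs G A)"
    and dom: "\<forall>P\<in>F. fst P = D"
    and T: "T \<in> configs G A \<rightarrow> configs G A" "T ` configs G A \<noteq> configs G A"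
  shows "\<exists>P. garden_of_eden_pattern G A T P \<and> fst P = D"
proof -
  interpret group G by fact
  obtain z where "z \<in> configs G A" "z \<notin> T ` configs G A"
    using T by blast
  then obtain P where P: "P \<in> F"
    using F unfolding defined_by_forbidden_def by blast
  have "restrict f (fst P) \<noteq> snd P" if f: "f \<in> T ` configs G A" for f
  proof -
    have fc: "f \<in> configs G A" using f T(1) by auto
    then have "shift G \<one>\<^bsub>G\<^esub> f = f"
      by (auto simp: shift_def configs_def PiE_def extensional_def fun_eq_iff)
    moreover have "restrict (shift G \<one>\<^bsub>G\<^esub> f) (fst P) \<noteq> snd P"
      using F f fc P unfolding defined_by_forbidden_def by (fastforce simp: case_prod_unfold)
    ultimately show ?thesis by simp
  qed
  moreover have "P \<in> patterns G A"
    using F P by (auto simp: defined_by_forbidden_def finite_patterns_def)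
  ultimately show ?thesis
    using dom P unfolding garden_of_eden_pattern_def by blast
qed

theorem theorem2p3:
  fixes G :: "('g, 'm) monoid_scheme" and A :: "'a set"
    and T :: "('g \<Rightarrow> 'a) \<Rightarrow> 'g \<Rightarrow> 'a" and M N :: "'g set"
  assumes "group G"
    and "finite A" and "card A \<ge> 2"
    and "cellular_automaton G A (configs G A) (configs G A) T"
    and "inj_on T (configs G A)"
    and "injectivity_set G (configs G A) T N" and "\<one>\<^bsub>G\<^esub> \<in> N"
    and "injectivity_set G (T ` configs G A) (inv_into (configs G A) T) M" and "\<one>\<^bsub>G\<^esub> \<in> M"
  shows "(subshift_of_finite_type G A (T ` configs G A) \<and>
          (\<exists>F. defined_by_forbidden G A F (T ` configs G A) \<and>
               (\<forall>P\<in>F. fst P = M <#>\<^bsub>G\<^esub> N))) \<and>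
         (\<forall>n::nat. subshift_of_finite_type G A ((T ^^ n) ` configs G A) \<and>
          (\<exists>F. defined_by_forbidden G A F ((T ^^ n) ` configs G A) \<and>
               (\<forall>P\<in>F. fst P = M <#>\<^bsub>G\<^esub> set_power G N n))) \<and>
         (T ` configs G A \<noteq> configs G A \<longrightarrow>
          (\<exists>P. garden_of_eden_pattern G A T P \<and> fst P = M <#>\<^bsub>G\<^esub> N))"
proof -
  interpret group G by fact
  let ?C = "configs G A"
  let ?X = "\<lambda>n. (T ^^ n) ` ?C" and ?D = "\<lambda>n. M <#>\<^bsub>G\<^esub> set_power G N n"
  have N: "finite N" "N \<subseteq> carrier G" and M: "finite M" "M \<subseteq> carrier G"
    using assms(6,8) by (auto simp: injectivity_set_def)
  have T: "T \<in> ?C \<rightarrow> ?C"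
    using assms(4)
    by (auto simp: cellular_automaton_def continuous_map_def topspace_config_topology Pi_iff)
  note pow = set_power_properties[OF assms(1) N assms(7)]
  have X_Suc: "?X (Suc n) = T ` ?X n" for n
    by (simp add: image_comp)
  have D_Suc: "?D (Suc n) = ?D n <#>\<^bsub>G\<^esub> N" for n
    using M(2) N(2) pow by (simp add: set_mult_assoc)
  have sub: "subshift G A (?X n)" for n
  proof (induction n)
    case 0
    then show ?case using subshift_configs[OF assms(1)] by simp
  next
    case (Suc n)
    then show ?case
      unfolding X_Suc by (intro subshift_image[OF assms(2,4)] subshift_subset_configs)
  qed
  have D: "M \<subseteq> ?D n" "?D n \<subseteq> carrier G" "finite (?D n)" for n
    using subset_set_mult_right[OF assms(1) M(2)] set_mult_closed[OF M(2)] pow[of n] M(1)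
    by (auto simp: set_mult_def)
  have det: "window_determined G A (?D n) (?X n)" for n
  proof (induction n)
    case 0
    then show ?case by (simp add: window_determined_def)
  next
    case (Suc n)
    show ?case
      unfolding X_Suc D_Suc
      using window_determined_image[OF assms(1) T assms(5-9) D(1,2)
          subshift_subset_configs[OF sub] Suc] .
  qed
  have defined: "defined_by_forbidden G A (absent_patterns A (?D n) (?X n)) (?X n)" for n
    by (rule absent_patterns_define[OF assms(1,2) D(3,2) sub det])
  have dom: "\<forall>P\<in>absent_patterns A E Y. fst P = E" for E :: "'g set" and Y :: "('g \<Rightarrow> 'a) set"
    by (auto simp: absent_patterns_def)
  have finite_type: "subshift_of_finite_type G A (?X n) \<and>
      (\<exists>F. defined_by_forbidden G A F (?X n) \<and> (\<forall>P\<in>F. fst P = ?D n))" for n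
    unfolding subshift_of_finite_type_def
    by (intro conjI exI) (rule sub defined dom)+
  have "set_power G N 1 = N"
    using N(2) by (force simp: set_mult_def)
  then have first: "subshift_of_finite_type G A (T ` ?C) \<and>
      (\<exists>F. defined_by_forbidden G A F (T ` ?C) \<and> (\<forall>P\<in>F. fst P = M <#>\<^bsub>G\<^esub> N))"
    using finite_type[of 1] by simp
  then have "T ` ?C \<noteq> ?C \<longrightarrow> (\<exists>P. garden_of_eden_pattern G A T P \<and> fst P = M <#>\<^bsub>G\<^esub> N)"
    using garden_of_eden_pattern_if_defined[OF assms(1) _ _ T] by blast
  then show ?thesis
    using first finite_type by blast
qed

end
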